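(* The integral congruence class of a unipotent companion is invariant under wiggles. That is, let $(Q,\sigma)$ be a cyclically ordered quiver on $n$ vertices and let $(Q,\sigma')$ be obtained from it by a wiggle. If $U$ (resp., $U'$) is the unipotent companion of $Q$ with respect to a linear ordering compatible with $\sigma$ (resp., $\sigma'$), then there exists $G\in\operatorname{GL}_n(\mathbb Z)$ such that $U'=GUG^T$.
   Context: A quiver is a finite directed graph without loops or oriented 2-cycles; multiple arrows are allowed. A cyclic ordering $\sigma=(v_1,\dots,v_n)$ of the vertex set is a linear ordering $v_1<\dots<v_n$ considered up to cyclic shifts; the $n$ linear orderings in this class are called compatible with $\sigma$. A cyclically ordered quiver (COQ) $(Q,\sigma)$ is a quiver with a cyclic ordering of its vertices. A wiggle transforms $(Q,\sigma)$ into $(Q,\sigma')$ where $\sigma'$ is obtained from $\sigma$ by interchanging two vertices that are consecutive in $\sigma$ and are not adjacent in $Q$ (no arrows between them). Given a linear ordering $v_1<\dots<v_n$ of the vertices, the exchange matrix $B=(b_{ij})$ is the skew-symmetric integer matrix with $b_{ij}=x$ if $Q$ contains $x\ge0$ arrows $v_i\to v_j$ and $b_{ij}=-x$ if $Q$ contains $x\ge 0$ arrows $v_j\to v_i$. The unipotent companion of $Q$ (with respect to this linear ordering) is the unique unipotent upper-triangular matrix $U$ with $-B=U-U^T$. Up to integral congruence ($L\sim GLG^T$, $G\in \operatorname{GL}_n(\mathbb Z)$), it does not depend on the choice of a compatible linear ordering for a given cyclic ordering. *)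

theory Defs
  imports
    "HOL-Combinatorics.Transposition"
    "Graph_Theory.Digraph"
    "Jordan_Normal_Form.Matrix"
begin

locale quiver = fin_digraph G + loopfree_digraph G for G (structure) +
  assumes no_two_cycles: "u \<rightarrow>\<^bsub>G\<^esub> v \<Longrightarrow> \<not> v \<rightarrow>\<^bsub>G\<^esub> u"

definition num_arrows :: "('v, 'e) pre_digraph \<Rightarrow> 'v \<Rightarrow> 'v \<Rightarrow> nat" where
  "num_arrows Q u v = card {e \<in> arcs Q. tail Q e = u \<and> head Q e = v}"

definition adjacent :: "('v, 'e) pre_digraph \<Rightarrow> 'v \<Rightarrow> 'v \<Rightarrow> bool" where
  "adjacent Q u v \<longleftrightarrow> u \<rightarrow>\<^bsub>Q\<^esub> v \<or> v \<rightarrow>\<^bsub>Q\<^esub> u"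

text \<open>The list \<open>[v\<^sub>1, \<dots>, v\<^sub>n]\<close> stands for the linear ordering \<open>v\<^sub>1 < \<dots> < v\<^sub>n\<close>.\<close>

definition linear_orderings :: "'v set \<Rightarrow> 'v list set" where
  "linear_orderings V = {vs. distinct vs \<and> set vs = V}"

definition cyclic_shifts :: "'v set \<Rightarrow> ('v list \<times> 'v list) set" where
  "cyclic_shifts V = {(vs, ws). vs \<in> linear_orderings V \<and> (\<exists>k. ws = rotate k vs)}"

text \<open>A cyclic ordering is an equivalence class of linear orderings under cyclic shifts; its
  elements are the compatible linear orderings.\<close>

definition cyclic_orderings :: "'v set \<Rightarrow> 'v list set set" where
  "cyclic_orderings V = linear_orderings V // cyclic_shifts V"

definition coq :: "('v, 'e) pre_digraph \<Rightarrow> 'v list set \<Rightarrow> bool" where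
  "coq Q \<sigma> \<longleftrightarrow> quiver Q \<and> \<sigma> \<in> cyclic_orderings (verts Q)"

text \<open>As \<open>\<sigma>\<close> is closed under cyclic shifts, the following also covers the last and the first
  vertex of a compatible linear ordering.\<close>

definition consecutive :: "'v list set \<Rightarrow> 'v \<Rightarrow> 'v \<Rightarrow> bool" where
  "consecutive \<sigma> u v \<longleftrightarrow> (\<exists>xs ys. xs @ [u, v] @ ys \<in> \<sigma>)"

definition wiggle :: "('v, 'e) pre_digraph \<Rightarrow> 'v list set \<Rightarrow> 'v list set \<Rightarrow> bool" where
  "wiggle Q \<sigma> \<sigma>' \<longleftrightarrow> (\<exists>u v. consecutive \<sigma> u v \<and> \<not> adjacent Q u v \<and>
     \<sigma>' = map (Transposition.transpose u v) ` \<sigma>)"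

text \<open>In a quiver at least one of the two terms of the difference is zero.\<close>

definition exchange_matrix :: "('v, 'e) pre_digraph \<Rightarrow> 'v list \<Rightarrow> int mat" where
  "exchange_matrix Q vs = mat (length vs) (length vs)
     (\<lambda>(i, j). int (num_arrows Q (vs ! i) (vs ! j)) - int (num_arrows Q (vs ! j) (vs ! i)))"

definition unipotent :: "'a :: ring_1 mat \<Rightarrow> bool" where
  "unipotent A \<longleftrightarrow> square_mat A \<and>
     (\<exists>k. (A - 1\<^sub>m (dim_row A)) ^\<^sub>m k = 0\<^sub>m (dim_row A) (dim_row A))"

definition unipotent_companion :: "('v, 'e) pre_digraph \<Rightarrow> 'v list \<Rightarrow> int mat \<Rightarrow> bool" where
  "unipotent_companion Q vs U \<longleftrightarrow> U \<in> carrier_mat (length vs) (length vs) \<and>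
     unipotent U \<and> upper_triangular U \<and> - exchange_matrix Q vs = U - transpose_mat U"

lemma equiv_cyclic_shifts: "equiv (linear_orderings V) (cyclic_shifts V)"
proof (rule equivI)
  show "cyclic_shifts V \<subseteq> linear_orderings V \<times> linear_orderings V"
    by (auto simp: cyclic_shifts_def linear_orderings_def)
  show "refl_on (linear_orderings V) (cyclic_shifts V)"
    by (auto simp: refl_on_def cyclic_shifts_def linear_orderings_def intro: exI[of _ 0])
  show "trans (cyclic_shifts V)"
    by (auto simp: trans_def cyclic_shifts_def rotate_rotate)
  show "sym (cyclic_shifts V)"
  proof (rule symI)
    fix vs ws assume "(vs, ws) \<in> cyclic_shifts V"
    then obtain k where vs: "vs \<in> linear_orderings V" and ws: "ws = rotate k vs"
      by (auto simp: cyclic_shifts_def)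
    have "rotate (length vs - k mod length vs) ws = vs"
    proof (cases "vs = []")
      case False
      then have "k mod length vs < length vs" by simp
      then have "rotate (length vs - k mod length vs) (rotate (k mod length vs) vs) = vs"
        by (simp add: rotate_rotate)
      then show ?thesis
        by (simp add: ws flip: rotate_conv_mod)
    qed (simp add: ws)
    then show "(ws, vs) \<in> cyclic_shifts V"
      using vs ws unfolding cyclic_shifts_def linear_orderings_def by (auto intro: sym)
  qed
qed

lemma upper_triangular_pow:
  fixes A :: "'a :: ring_1 mat"
  assumes A: "A \<in> carrier_mat n n" and ut: "upper_triangular A"
  shows "upper_triangular (A ^\<^sub>m k) \<and> (\<forall>i<n. (A ^\<^sub>m k) $$ (i, i) = (A $$ (i, i)) ^ k)"
proof (induction k)
  case 0
  then show ?case using A by simp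
next
  case (Suc k)
  have P: "A ^\<^sub>m k \<in> carrier_mat n n" using A by simp
  have ent: "(A ^\<^sub>m Suc k) $$ (i, j) = (\<Sum>l<n. (A ^\<^sub>m k) $$ (i, l) * A $$ (l, j))"
    if "i < n" "j < n" for i j
    using that A P by (simp add: scalar_prod_def atLeast0LessThan)
  have z: "(A ^\<^sub>m k) $$ (i, l) * A $$ (l, j) = 0" if "i < n" "l < n" "j \<le> i" "\<not> (l = i \<and> j = i)" for i j l
    using Suc that A P upper_triangularD[of "A ^\<^sub>m k" l i] upper_triangularD[OF ut, of j l]
    by (cases "l < i") auto
  have "(A ^\<^sub>m Suc k) $$ (i, j) = 0" if "i < n" "j < i" for i j
    unfolding ent[OF that(1) less_trans[OF that(2,1)]] using z that by (intro sum.neutral) auto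
  moreover have "(A ^\<^sub>m Suc k) $$ (i, i) = (A $$ (i, i)) ^ Suc k" if "i < n" for i
  proof -
    have "(\<Sum>l<n. (A ^\<^sub>m k) $$ (i, l) * A $$ (l, i)) = (\<Sum>l\<in>{i}. (A ^\<^sub>m k) $$ (i, l) * A $$ (l, i))"
      using that z[of i _ i] by (intro sum.mono_neutral_right) auto
    then show ?thesis using ent[of i i] Suc that by (simp add: power_Suc2 del: power_Suc)
  qed
  ultimately show ?case using A by (intro conjI upper_triangularI) auto
qed

lemma strictly_upper_triangular_pow:
  fixes A :: "'a :: ring_1 mat"
  assumes A: "A \<in> carrier_mat n n" and ut: "\<And>i j. i < n \<Longrightarrow> j \<le> i \<Longrightarrow> A $$ (i, j) = 0"
  shows "i < n \<Longrightarrow> j < n \<Longrightarrow> j < i + k \<Longrightarrow> (A ^\<^sub>m k) $$ (i, j) = 0"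
proof (induction k arbitrary: j)
  case 0
  then show ?case using A by simp
next
  case (Suc k)
  have P: "A ^\<^sub>m k \<in> carrier_mat n n" using A by simp
  have "(A ^\<^sub>m Suc k) $$ (i, j) = (\<Sum>l<n. (A ^\<^sub>m k) $$ (i, l) * A $$ (l, j))"
    using Suc.prems A P by (simp add: scalar_prod_def atLeast0LessThan)
  also have "\<dots> = 0"
  proof (intro sum.neutral ballI)
    fix l assume "l \<in> {..<n}"
    then show "(A ^\<^sub>m k) $$ (i, l) * A $$ (l, j) = 0"
      using Suc.IH[of l] Suc.prems ut[of l j] by (cases "l < i + k") auto
  qed
  finally show ?case .
qed

lemma unipotent_upper_triangular_iff:
  fixes A :: "'a :: idom mat"
  assumes A: "A \<in> carrier_mat n n" and ut: "upper_triangular A"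
  shows "unipotent A \<longleftrightarrow> (\<forall>i<n. A $$ (i, i) = 1)"
proof
  let ?N = "A - 1\<^sub>m n"
  have N: "?N \<in> carrier_mat n n" by (simp add: minus_carrier_mat)
  have utN: "upper_triangular ?N"
    using A ut by (intro upper_triangularI) auto
  show "\<forall>i<n. A $$ (i, i) = 1" if uni: "unipotent A"
  proof (intro allI impI)
    fix i assume i: "i < n"
    obtain k where "?N ^\<^sub>m k = 0\<^sub>m n n"
      using uni A by (auto simp: unipotent_def)
    then have "(?N $$ (i, i)) ^ k = 0"
      using upper_triangular_pow[OF N utN, of k] i by auto
    then have "?N $$ (i, i) = 0" by simp
    then show "A $$ (i, i) = 1" using i A by simp
  qed
  show "unipotent A" if d: "\<forall>i<n. A $$ (i, i) = 1"
  proof -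
    have "?N $$ (i, j) = 0" if "i < n" "j \<le> i" for i j
      using that A d upper_triangularD[OF ut, of j i] by (cases "j = i") auto
    from strictly_upper_triangular_pow[OF N this]
    have "?N ^\<^sub>m n = 0\<^sub>m n n" using N A by (intro eq_matI) auto
    then show ?thesis using A by (auto simp: unipotent_def)
  qed
qed

lemma ex1_unipotent_companion: "\<exists>!U. unipotent_companion Q vs U"
proof -
  let ?n = "length vs" and ?B = "exchange_matrix Q vs"
  have B: "?B \<in> carrier_mat ?n ?n" by (simp add: exchange_matrix_def)
  have skew: "?B $$ (i, j) = - ?B $$ (j, i)" if "i < ?n" "j < ?n" for i j
    using that by (simp add: exchange_matrix_def)
  define U where "U = mat ?n ?n (\<lambda>(i, j). if i = j then 1 else if i < j then - ?B $$ (i, j) else 0)"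
  have U: "U \<in> carrier_mat ?n ?n" by (simp add: U_def)
  have utU: "upper_triangular U" by (auto simp: U_def)
  show ?thesis
  proof (rule ex1I)
    have "- ?B = U - transpose_mat U"
    proof (rule eq_matI)
      fix i j assume "i < dim_row (U - transpose_mat U)" "j < dim_col (U - transpose_mat U)"
      then have ij: "i < ?n" "j < ?n" using U by auto
      then show "(- ?B) $$ (i, j) = (U - transpose_mat U) $$ (i, j)"
        using B U skew[OF ij] skew[of i i]
        by (cases i j rule: linorder_cases) (auto simp: U_def)
    qed (use B U in auto)
    then show "unipotent_companion Q vs U"
      unfolding unipotent_companion_def
      using U utU unipotent_upper_triangular_iff[OF U utU] by (auto simp: U_def)
  next
    fix W assume "unipotent_companion Q vs W"
    then have W: "W \<in> carrier_mat ?n ?n" and ut: "upper_triangular W" and uni: "unipotent W"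
      and eq: "- ?B = W - transpose_mat W" by (auto simp: unipotent_companion_def)
    have d: "\<forall>i<?n. W $$ (i, i) = 1" using unipotent_upper_triangular_iff[OF W ut] uni by simp
    show "W = U"
    proof (rule eq_matI)
      fix i j assume "i < dim_row U" "j < dim_col U"
      then have ij: "i < ?n" "j < ?n" using U by auto
      have "(- ?B) $$ (i, j) = (W - transpose_mat W) $$ (i, j)" using eq by simp
      then have "- ?B $$ (i, j) = W $$ (i, j) - W $$ (j, i)" using ij B W by simp
      then show "W $$ (i, j) = U $$ (i, j)"
        using ij W d upper_triangularD[OF ut, of i j] upper_triangularD[OF ut, of j i]
        by (cases i j rule: linorder_cases) (auto simp: U_def)
    qed (use W U in auto)
  qed
qed

end

theory Submission
  imports Defs
begin

text \<open>It suffices to treat two moves of a linear ordering. Interchanging two adjacent entries which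
  are not joined by an arrow permutes the rows and columns of the unipotent companion. Moving the
  first vertex to the end is a congruence as well: for the bilinear form with Gram matrix \<open>U\<close> in the
  basis \<open>e\<^sub>1, \<dots>, e\<^sub>n\<close>, the new companion is the Gram matrix in the basis
  \<open>e\<^sub>2 - a\<^sub>2 e\<^sub>1, \<dots>, e\<^sub>n - a\<^sub>n e\<^sub>1, e\<^sub>1\<close>, where \<open>(1, a\<^sub>2, \<dots>, a\<^sub>n)\<close> is the first row of \<open>U\<close>.\<close>

section \<open>Congruence of square matrices over a commutative ring\<close>

definition congruent_mat :: "nat \<Rightarrow> 'a :: comm_ring_1 mat \<Rightarrow> 'a mat \<Rightarrow> bool" where
  "congruent_mat n A B \<longleftrightarrow>
     (\<exists>G \<in> carrier_mat n n. invertible_mat G \<and> B = G * A * transpose_mat G)"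

lemma invertible_matI:
  assumes "G \<in> carrier_mat n n" "H \<in> carrier_mat n n" "G * H = 1\<^sub>m n" "H * G = 1\<^sub>m n"
  shows "invertible_mat G"
  using assms by (auto simp: invertible_mat_def inverts_mat_def)

lemma invertible_matE:
  assumes "invertible_mat G" "G \<in> carrier_mat n n"
  obtains H where "H \<in> carrier_mat n n" "G * H = 1\<^sub>m n" "H * G = 1\<^sub>m n"
proof -
  obtain H where H: "G * H = 1\<^sub>m n" "H * G = 1\<^sub>m (dim_row H)"
    using assms by (auto simp: invertible_mat_def inverts_mat_def)
  \<comment> \<open>\<open>inverts_mat\<close> leaves the shape of \<open>H\<close> open; comparing
    the column counts on both sides of the two inverse equations fixes it.\<close>
  have "dim_col H = n"
    using arg_cong[OF H(1), of dim_col] by simp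
  moreover have "dim_row H = n"
    using arg_cong[OF H(2), of dim_col] assms(2) by simp
  ultimately show ?thesis
    using H by (intro that[of H]) auto
qed

lemma invertible_mat_mult:
  assumes "invertible_mat A" "invertible_mat B" and A: "A \<in> carrier_mat n n" and B: "B \<in> carrier_mat n n"
  shows "invertible_mat (A * B)"
proof -
  obtain A' where A': "A' \<in> carrier_mat n n" "A * A' = 1\<^sub>m n" "A' * A = 1\<^sub>m n"
    using assms by (auto elim: invertible_matE)
  obtain B' where B': "B' \<in> carrier_mat n n" "B * B' = 1\<^sub>m n" "B' * B = 1\<^sub>m n"
    using assms by (auto elim: invertible_matE)
  \<comment> \<open>The cancellation is stated for arbitrary factors because it serves twice: for
    \<open>A * B\<close> times the candidate inverse \<open>B' * A'\<close>, and for the product in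
    the opposite order.\<close>
  have *: "(X * Y) * (Y' * X') = 1\<^sub>m n"
    if "X \<in> carrier_mat n n" "X' \<in> carrier_mat n n" "Y \<in> carrier_mat n n" "Y' \<in> carrier_mat n n"
       "X * X' = 1\<^sub>m n" "Y * Y' = 1\<^sub>m n" for X X' Y Y' :: "'a mat"
  proof -
    have "(X * Y) * (Y' * X') = X * (Y * (Y' * X'))"
      using that by (intro assoc_mult_mat) auto
    also have "Y * (Y' * X') = (Y * Y') * X'"
      using that by (intro assoc_mult_mat[symmetric]) auto
    finally show ?thesis using that by simp
  qed
  show ?thesis
    using *[of A A' B B'] *[of B' B A' A] A B A' B'
    by (intro invertible_matI[of _ n "B' * A'"]) auto
qed

lemma congruent_mat_refl:
  assumes "A \<in> carrier_mat n n"
  shows "congruent_mat n A A"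
  using assms unfolding congruent_mat_def
  by (intro bexI[of _ "1\<^sub>m n"]) (auto intro: invertible_matI[of _ n "1\<^sub>m n"])

text \<open>The change of basis \<open>G\<close> followed by \<open>H\<close> is the single change
  of basis \<open>H * G\<close>.\<close>

lemma congruent_mat_trans:
  assumes "congruent_mat n A B" "congruent_mat n B C" and A: "A \<in> carrier_mat n n"
  shows "congruent_mat n A C"
proof -
  obtain G where G: "G \<in> carrier_mat n n" "invertible_mat G" "B = G * A * transpose_mat G"
    using assms by (auto simp: congruent_mat_def)
  obtain H where H: "H \<in> carrier_mat n n" "invertible_mat H" "C = H * B * transpose_mat H"
    using assms by (auto simp: congruent_mat_def)
  have GT: "transpose_mat G \<in> carrier_mat n n" and HT: "transpose_mat H \<in> carrier_mat n n"
    using G H by auto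
  have GA: "G * A \<in> carrier_mat n n" using G A by simp
  have "C = (H * (G * A)) * transpose_mat G * transpose_mat H"
    using assoc_mult_mat[OF H(1) GA GT] H(3) G(3) by simp
  also have "\<dots> = (H * (G * A)) * (transpose_mat G * transpose_mat H)"
    using assoc_mult_mat[OF mult_carrier_mat[OF H(1) GA] GT HT] .
  also have "transpose_mat G * transpose_mat H = transpose_mat (H * G)"
    using transpose_mult[OF H(1) G(1)] by simp
  also have "H * (G * A) = H * G * A"
    using assoc_mult_mat[OF H(1) G(1) A] by simp
  finally show ?thesis
    unfolding congruent_mat_def using G H by (auto intro!: bexI[of _ "H * G"] invertible_mat_mult)
qed

section \<open>The two matrix congruences behind the moves of a linear ordering\<close>

lemma congruent_mat_permute_involution:
  assumes A: "A \<in> carrier_mat n n" and p: "\<And>i. i < n \<Longrightarrow> p i < n" "\<And>i. i < n \<Longrightarrow> p (p i) = i"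
  shows "congruent_mat n A (mat n n (\<lambda>(i, j). A $$ (p i, p j)))"
proof -
  \<comment> \<open>The permutation matrix of \<open>p\<close>: multiplying by it from the left
    permutes rows, so it is its own inverse because \<open>p\<close> is an involution.\<close>
  define P :: "'a mat" where "P = mat n n (\<lambda>(i, j). if j = p i then 1 else 0)"
  have P: "P \<in> carrier_mat n n" by (simp add: P_def)
  have left: "P * X = mat n n (\<lambda>(i, j). X $$ (p i, j))" if "X \<in> carrier_mat n n" for X
    using that p by (intro eq_matI) (auto simp: P_def scalar_prod_def if_distrib if_distribR
        sum.delta cong: if_cong)
  have inv: "P * P = 1\<^sub>m n"
    unfolding left[OF P] using p by (intro eq_matI) (auto simp: P_def)
  have right: "X * transpose_mat P = mat n n (\<lambda>(i, j). X $$ (i, p j))" if X: "X \<in> carrier_mat n n" for X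
  proof -
    \<comment> \<open>The column rule is the row rule for the transposed matrix.\<close>
    have "X * transpose_mat P = transpose_mat (P * transpose_mat X)"
      using transpose_mult[OF P, of "transpose_mat X"] X by simp
    also have "P * transpose_mat X = mat n n (\<lambda>(i, j). transpose_mat X $$ (p i, j))"
      using X by (intro left) auto
    finally show ?thesis using X p by (auto intro!: eq_matI)
  qed
  have "P * A * transpose_mat P = mat n n (\<lambda>(i, j). A $$ (p i, p j))"
    unfolding left[OF A] using p by (subst right) (auto intro!: eq_matI)
  then show ?thesis
    using P invertible_matI[OF P P inv inv] unfolding congruent_mat_def by metis
qed

text \<open>Read the first matrix as the Gram matrix of a form b in a basis e_1, ..., e_(m+1), and
  let a_i be the entry of \<open>a\<close> belonging to e_i. The vectors f_i = e_i - a_i e_1 satisfy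
  b(e_1, f_i) = 0, and b(e_i, e_1) = 0 for i > 1. Hence the f_i still have Gram matrix
  \<open>W\<close>, and b(f_i, e_1) = -a_i fills the last column once e_1 is listed last.\<close>

lemma congruent_mat_rotate_block:
  fixes a W :: "'a :: comm_ring_1 mat"
  assumes a: "a \<in> carrier_mat 1 m" and W: "W \<in> carrier_mat m m"
  shows "congruent_mat (Suc m) (four_block_mat (1\<^sub>m 1) a (0\<^sub>m m 1) W)
           (four_block_mat W (- transpose_mat a) (0\<^sub>m 1 m) (1\<^sub>m 1))"
proof -
  define t where "t = - transpose_mat a"
  let ?U = "four_block_mat (1\<^sub>m 1) a (0\<^sub>m m 1) W"
  have t: "t \<in> carrier_mat m 1" and ta: "t * a \<in> carrier_mat m m"
    using a by (simp_all add: t_def)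
  have tT: "transpose_mat t = - a"
    by (simp add: t_def transpose_uminus)
  have [simp]: "- 0\<^sub>m k l = (0\<^sub>m k l :: 'a mat)" for k l
    by (intro eq_matI) auto
  \<comment> \<open>The rows of \<open>G\<close> are the coordinates of the f_i and then of e_1 in
    the old basis. Conversely, \<open>H\<close> expresses the old basis in the new one, by e_i = f_i
    + a_i e_1.\<close>
  define G where "G = four_block_mat t (1\<^sub>m m) (1\<^sub>m 1) (0\<^sub>m 1 m)"
  define H where "H = four_block_mat (0\<^sub>m 1 m) (1\<^sub>m 1) (1\<^sub>m m) (- t)"
  have G: "G \<in> carrier_mat (Suc m) (Suc m)" and H: "H \<in> carrier_mat (Suc m) (Suc m)"
    using t by (auto simp: G_def H_def intro!: carrier_matI)
  have "G * H = four_block_mat (t * 0\<^sub>m 1 m + 1\<^sub>m m * 1\<^sub>m m) (t * 1\<^sub>m 1 + 1\<^sub>m m * (- t))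
      (1\<^sub>m 1 * 0\<^sub>m 1 m + 0\<^sub>m 1 m * 1\<^sub>m m) (1\<^sub>m 1 * 1\<^sub>m 1 + 0\<^sub>m 1 m * (- t))"
    unfolding G_def H_def using t by (intro mult_four_block_mat) auto
  then have GH: "G * H = 1\<^sub>m (Suc m)"
    using t comm_add_mat[OF t uminus_carrier_mat[OF t]] uminus_l_inv_mat[OF t] by simp
  have "H * G = four_block_mat (0\<^sub>m 1 m * t + 1\<^sub>m 1 * 1\<^sub>m 1) (0\<^sub>m 1 m * 1\<^sub>m m + 1\<^sub>m 1 * 0\<^sub>m 1 m)
      (1\<^sub>m m * t + (- t) * 1\<^sub>m 1) (1\<^sub>m m * 1\<^sub>m m + (- t) * 0\<^sub>m 1 m)"
    unfolding G_def H_def using t by (intro mult_four_block_mat) auto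
  then have HG: "H * G = 1\<^sub>m (Suc m)"
    using t comm_add_mat[OF t uminus_carrier_mat[OF t]] uminus_l_inv_mat[OF t] by simp
  have "G * ?U = four_block_mat (t * 1\<^sub>m 1 + 1\<^sub>m m * 0\<^sub>m m 1) (t * a + 1\<^sub>m m * W)
      (1\<^sub>m 1 * 1\<^sub>m 1 + 0\<^sub>m 1 m * 0\<^sub>m m 1) (1\<^sub>m 1 * a + 0\<^sub>m 1 m * W)"
    unfolding G_def using a t W by (intro mult_four_block_mat) auto
  then have GU: "G * ?U = four_block_mat t (t * a + W) (1\<^sub>m 1) a"
    using a t W by simp
  have GT: "transpose_mat G = four_block_mat (- a) (1\<^sub>m 1) (1\<^sub>m m) (0\<^sub>m m 1)"
    unfolding G_def using t by (simp add: transpose_four_block_mat[of _ m 1 _ m _ 1] tT)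
  have "t * (- a) + (t * a + W) = W"
    using a t W ta by (intro eq_matI) auto
  moreover have "G * ?U * transpose_mat G =
      four_block_mat (t * (- a) + (t * a + W) * 1\<^sub>m m) (t * 1\<^sub>m 1 + (t * a + W) * 0\<^sub>m m 1)
        (1\<^sub>m 1 * (- a) + a * 1\<^sub>m m) (1\<^sub>m 1 * 1\<^sub>m 1 + a * 0\<^sub>m m 1)"
    unfolding GU GT using a t W ta by (intro mult_four_block_mat) auto
  moreover have "(t * a + W) * 1\<^sub>m m = t * a + W" "(t * a + W) * 0\<^sub>m m 1 = 0\<^sub>m m 1"
    using ta W by (auto intro!: right_mult_one_mat right_mult_zero_mat)
  ultimately have "G * ?U * transpose_mat G = four_block_mat W t (0\<^sub>m 1 m) (1\<^sub>m 1)"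
    using a t W ta uminus_l_inv_mat[OF a] by simp
  then show ?thesis
    using G invertible_matI[OF G H GH HG] unfolding congruent_mat_def t_def by metis
qed

section \<open>An explicit form of the unipotent companion\<close>

definition net_arrows :: "('v, 'e) pre_digraph \<Rightarrow> 'v \<Rightarrow> 'v \<Rightarrow> int" where
  "net_arrows Q u v = int (num_arrows Q u v) - int (num_arrows Q v u)"

lemma net_arrows_swap: "net_arrows Q v u = - net_arrows Q u v"
  by (simp add: net_arrows_def)

lemma net_arrows_eq_0_if_not_adjacent:
  assumes "\<not> adjacent Q u v"
  shows "net_arrows Q u v = 0"
proof -
  have "{e \<in> arcs Q. tail Q e = u \<and> head Q e = v} = {}" "{e \<in> arcs Q. tail Q e = v \<and> head Q e = u} = {}"
    using assms by (auto simp: adjacent_def arcs_ends_conv)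
  then show ?thesis
    by (simp only: net_arrows_def num_arrows_def)
qed

text \<open>The arguments of \<open>net_arrows\<close> are reversed because
  \<open>U - transpose_mat U\<close> equals minus the exchange matrix. Off the diagonal, entries are
  given by vertices, which makes reorderings easy to follow.\<close>

definition companion_mat :: "('v, 'e) pre_digraph \<Rightarrow> 'v list \<Rightarrow> int mat" where
  "companion_mat Q vs = mat (length vs) (length vs)
     (\<lambda>(i, j). if i = j then 1 else if i < j then net_arrows Q (vs ! j) (vs ! i) else 0)"

lemma companion_mat_carrier: "companion_mat Q vs \<in> carrier_mat (length vs) (length vs)"
  by (simp add: companion_mat_def)

text \<open>An upper triangular unipotent matrix over the integers has unit diagonal. Above the
  diagonal \<open>transpose_mat U\<close> vanishes, so the defining equation determines the entries
  of \<open>U\<close> there.\<close>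

lemma unipotent_companion_eq:
  assumes "unipotent_companion Q vs U"
  shows "U = companion_mat Q vs"
proof -
  let ?n = "length vs" and ?B = "exchange_matrix Q vs"
  have U: "U \<in> carrier_mat ?n ?n" and ut: "upper_triangular U" and uni: "unipotent U"
    and eq: "- ?B = U - transpose_mat U"
    using assms by (auto simp: unipotent_companion_def)
  have d: "\<forall>i<?n. U $$ (i, i) = 1"
    using unipotent_upper_triangular_iff[OF U ut] uni by simp
  have "U $$ (i, j) = companion_mat Q vs $$ (i, j)" if ij: "i < ?n" "j < ?n" for i j
  proof -
    have "(- ?B) $$ (i, j) = (U - transpose_mat U) $$ (i, j)"
      using eq by simp
    then have "net_arrows Q (vs ! j) (vs ! i) = U $$ (i, j) - U $$ (j, i)"
      using ij U by (simp add: exchange_matrix_def net_arrows_def)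
    then show ?thesis
      using ij U d upper_triangularD[OF ut, of i j] upper_triangularD[OF ut, of j i]
      by (cases i j rule: linorder_cases) (auto simp: companion_mat_def)
  qed
  then show ?thesis
    using U by (intro eq_matI) (auto simp: companion_mat_def)
qed

section \<open>Effect of rotations and swaps on the companion\<close>

lemma congruent_companion_mat_rotate1:
  "congruent_mat (length vs) (companion_mat Q vs) (companion_mat Q (rotate1 vs))"
proof (cases vs)
  case Nil
  then show ?thesis
    using companion_mat_carrier[of Q vs] by (simp add: congruent_mat_refl)
next
  case (Cons x xs)
  define m where "m = length xs"
  define a where "a = mat 1 m (\<lambda>(_, j). net_arrows Q (xs ! j) x)"
  let ?W = "companion_mat Q xs"
  have "companion_mat Q (x # xs) = four_block_mat (1\<^sub>m 1) a (0\<^sub>m m 1) ?W"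
  proof (rule eq_matI, goal_cases)
    case (1 i j)
    then show ?case
      by (cases i; cases j) (auto simp: companion_mat_def a_def m_def)
  qed (simp_all add: companion_mat_def m_def)
  \<comment> \<open>With \<open>x\<close> last, its arrows are counted with the opposite
    orientation, so the former first row reappears as a negated column; the block of
    \<open>xs\<close> is unchanged.\<close>
  moreover have "companion_mat Q (xs @ [x]) = four_block_mat ?W (- transpose_mat a) (0\<^sub>m 1 m) (1\<^sub>m 1)"
  proof (rule eq_matI, goal_cases)
    case (1 i j)
    then have "i < m \<or> i = m" "j < m \<or> j = m"
      by (auto simp: companion_mat_def m_def)
    then show ?case
      using net_arrows_swap[of Q x "xs ! i"]
      by (auto simp: companion_mat_def a_def m_def nth_append)
  qed (simp_all add: companion_mat_def m_def)
  ultimately show ?thesis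
    using congruent_mat_rotate_block[of a m ?W] companion_mat_carrier[of Q xs]
    by (simp add: Cons a_def m_def)
qed

lemma congruent_companion_mat_rotate:
  "congruent_mat (length vs) (companion_mat Q vs) (companion_mat Q (rotate k vs))"
proof (induction k)
  case 0
  show ?case
    by (simp add: congruent_mat_refl companion_mat_carrier)
next
  case (Suc k)
  then show ?case
    using congruent_companion_mat_rotate1[of "rotate k vs" Q] companion_mat_carrier[of Q vs]
    by (auto intro: congruent_mat_trans)
qed

text \<open>Exchanging positions \<open>k\<close> and \<open>Suc k\<close> preserves the relative
  order of every other pair of positions. For this one pair the order is reversed, but the entry is
  zero since \<open>u\<close> and \<open>v\<close> are not adjacent; hence permuting rows and
  columns keeps the matrix triangular.\<close>

lemma congruent_companion_mat_swap:
  assumes "\<not> adjacent Q u v"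
  shows "congruent_mat (length (xs @ [u, v] @ ys)) (companion_mat Q (xs @ [u, v] @ ys))
           (companion_mat Q (xs @ [v, u] @ ys))"
proof -
  let ?vs = "xs @ [u, v] @ ys" and ?ws = "xs @ [v, u] @ ys"
  define k where "k = length xs"
  define p where "p = Transposition.transpose k (Suc k)"
  have len: "length ?ws = length ?vs" "Suc k < length ?vs"
    by (simp_all add: k_def)
  have p_lt: "p i < length ?vs" if "i < length ?vs" for i
    using that len by (auto simp: p_def Transposition.transpose_def)
  have nth: "?ws ! i = ?vs ! p i" for i
    by (auto simp: p_def Transposition.transpose_def k_def nth_append nth_Cons')
  have k: "?vs ! k = u" "?vs ! Suc k = v"
    by (simp_all add: k_def nth_append)
  have net: "net_arrows Q u v = 0" "net_arrows Q v u = 0"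
    using net_arrows_eq_0_if_not_adjacent[OF assms] net_arrows_swap[of Q v u] by simp_all
  have "companion_mat Q ?ws = mat (length ?vs) (length ?vs)
      (\<lambda>(i, j). companion_mat Q ?vs $$ (p i, p j))"
  proof (rule eq_matI, goal_cases)
    case (1 i j)
    then have ij: "i < length ?vs" "j < length ?vs" by auto
    have "p i < p j \<longleftrightarrow> i < j" if "\<not> (i \<in> {k, Suc k} \<and> j \<in> {k, Suc k})"
      using that by (auto simp: p_def Transposition.transpose_def)
    moreover have "p i = p j \<longleftrightarrow> i = j"
      using inj_eq[OF inj_transpose] by (simp add: p_def)
    moreover have "net_arrows Q (?vs ! p j) (?vs ! p i) = 0" if "i \<in> {k, Suc k}" "j \<in> {k, Suc k}" "i \<noteq> j"
      using that k net by (auto simp: p_def)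
    ultimately have "(if i = j then 1 else if i < j then net_arrows Q (?vs ! p j) (?vs ! p i) else 0) =
        (if p i = p j then 1 else if p i < p j then net_arrows Q (?vs ! p j) (?vs ! p i) else 0)"
      by (smt (verit, best))
    then have "companion_mat Q ?ws $$ (i, j) = companion_mat Q ?vs $$ (p i, p j)"
      unfolding companion_mat_def len(1) using ij p_lt[OF ij(1)] p_lt[OF ij(2)]
      by (simp only: index_mat split nth)
    then show ?case
      using ij by simp
  qed (simp_all add: companion_mat_def)
  then show ?thesis
    using congruent_mat_permute_involution[OF companion_mat_carrier[of Q ?vs], of p] p_lt
    by (simp add: p_def)
qed

section \<open>Invariance under a wiggle\<close>

theorem proposition4p5:
  fixes Q :: "('v, 'e) pre_digraph"
    and \<sigma> \<sigma>' :: "'v list set"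
    and vs vs' :: "'v list"
    and U U' :: "int mat"
    and n :: nat
  assumes "coq Q \<sigma>"
    and "card (verts Q) = n"
    and "wiggle Q \<sigma> \<sigma>'"
    and "vs \<in> \<sigma>" and "unipotent_companion Q vs U"
    and "vs' \<in> \<sigma>'" and "unipotent_companion Q vs' U'"
  shows "\<exists>G :: int mat. G \<in> carrier_mat n n \<and> invertible_mat G \<and> U' = G * U * transpose_mat G"
proof -
  obtain u v xs ys where xy: "xs @ [u, v] @ ys \<in> \<sigma>" and nadj: "\<not> adjacent Q u v"
    and \<sigma>': "\<sigma>' = map (Transposition.transpose u v) ` \<sigma>"
    using assms(3) by (auto simp: wiggle_def consecutive_def)
  obtain ws where ws: "ws \<in> \<sigma>" "vs' = map (Transposition.transpose u v) ws"
    using assms(6) \<sigma>' by auto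
  have "\<sigma> \<in> linear_orderings (verts Q) // cyclic_shifts (verts Q)"
    using assms(1) by (simp add: coq_def cyclic_orderings_def)
  from in_quotient_imp_in_rel[OF equiv_cyclic_shifts this]
  have shift: "(as, bs) \<in> cyclic_shifts (verts Q)" if "as \<in> \<sigma>" "bs \<in> \<sigma>" for as bs
    using that by simp
  \<comment> \<open>Members of the same cyclic ordering differ by a rotation, so \<open>vs\<close>
    can be turned until \<open>u\<close> and \<open>v\<close> are neighbours, even if they were its
    last and first entries.\<close>
  obtain k where k: "xs @ [u, v] @ ys = rotate k vs"
    using shift[OF assms(4) xy] by (auto simp: cyclic_shifts_def)
  have vs: "distinct vs" "set vs = verts Q"
    using shift[OF assms(4) xy] by (auto simp: cyclic_shifts_def linear_orderings_def)
  obtain l where l: "ws = rotate l (xs @ [u, v] @ ys)"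
    using shift[OF xy ws(1)] by (auto simp: cyclic_shifts_def)
  have len: "length vs = n" "length (xs @ [u, v] @ ys) = n"
    using vs assms(2) k by (auto simp: distinct_card[symmetric])
  \<comment> \<open>By distinctness neither \<open>u\<close> nor \<open>v\<close> occurs in
    \<open>xs\<close> or \<open>ys\<close>, so renaming vertices by the transposition only swaps the
    two neighbours. Renaming commutes with rotation, which carries this over to
    \<open>vs'\<close>.\<close>
  have "distinct (xs @ [u, v] @ ys)"
    using vs k by simp
  then have "map (Transposition.transpose u v) (xs @ [u, v] @ ys) = xs @ [v, u] @ ys"
    by (auto intro!: map_idI transpose_apply_other)
  then have vs': "vs' = rotate l (xs @ [v, u] @ ys)"
    unfolding ws(2) l rotate_map[symmetric] by simp
  \<comment> \<open>The chain from \<open>vs\<close> to \<open>vs'\<close> is a rotation, the swap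
    and a second rotation.\<close>
  have "congruent_mat n (companion_mat Q vs) (companion_mat Q (xs @ [u, v] @ ys))"
    using congruent_companion_mat_rotate[of vs Q k] len k by simp
  moreover have "congruent_mat n (companion_mat Q (xs @ [u, v] @ ys)) (companion_mat Q (xs @ [v, u] @ ys))"
    using congruent_companion_mat_swap[OF nadj, of xs ys] len by simp
  moreover have "congruent_mat n (companion_mat Q (xs @ [v, u] @ ys)) (companion_mat Q vs')"
    using congruent_companion_mat_rotate[of "xs @ [v, u] @ ys" Q l] len vs' by simp
  moreover have "companion_mat Q vs \<in> carrier_mat n n"
    using companion_mat_carrier[of Q vs] len by simp
  ultimately have "congruent_mat n (companion_mat Q vs) (companion_mat Q vs')"
    by (blast intro: congruent_mat_trans)
  then show ?thesis
    using assms(5,7)[THEN unipotent_companion_eq] by (auto simp: congruent_mat_def)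
qed

end
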